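(* There is an absolute constant $c>0$ such that the following holds. Let $q$ be a prime power, let $n\ge 1$, and let $A\subset\mathbb{F}_q^n$ be a set of size $\alpha q^n$. If $A$ contains no non-trivial solution to $x+y+z=3w$, then \[ \alpha \le \exp\left(-c\, n^{1/5}\right). \]
   Context: A solution $(x,y,z,w)\in A^4$ to $x+y+z=3w$ is trivial if $x=y=z=w$, and non-trivial otherwise. *)

theory Defs
  imports Complex_Main "HOL-Algebra.Algebra" "HOL-Number_Theory.Prime_Powers"
begin

text \<open>
  An absolute constant cannot be quantified outside a type-indexed family of statements, so finite
  fields are taken as fields in the sense of HOL-Algebra whose carrier is a set of natural numbers.
  The next lemma shows that no finite field is lost, up to isomorphism.
\<close>

lemma finite_field_nat_copy:
  assumes "field R" and "finite (carrier R)"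
  shows "\<exists>S :: nat ring. field S \<and> R \<simeq> S"
proof -
  obtain f :: "_ \<Rightarrow> nat" where f: "inj_on f (carrier R)"
    using assms(2) finite_imp_inj_to_nat_seg by blast
  have "field (image_ring f R)"
    using field.inj_imp_image_ring_is_field[OF assms(1) f] .
  moreover have "R \<simeq> image_ring f R"
    using inj_imp_image_ring_iso[OF f]
    unfolding is_ring_iso_def by blast
  ultimately show ?thesis by blast
qed

text \<open>Vectors are extensional functions, so equality in the space is equality of functions.\<close>

definition coord_space :: "('a, 'b) ring_scheme \<Rightarrow> nat \<Rightarrow> (nat \<Rightarrow> 'a) set" where
  "coord_space R n = {..<n} \<rightarrow>\<^sub>E carrier R"

definition vec_add ::
    "('a, 'b) ring_scheme \<Rightarrow> nat \<Rightarrow> (nat \<Rightarrow> 'a) \<Rightarrow> (nat \<Rightarrow> 'a) \<Rightarrow> (nat \<Rightarrow> 'a)" where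
  "vec_add R n x y = (\<lambda>i\<in>{..<n}. x i \<oplus>\<^bsub>R\<^esub> y i)"

definition vec_nat_mult ::
    "('a, 'b) ring_scheme \<Rightarrow> nat \<Rightarrow> nat \<Rightarrow> (nat \<Rightarrow> 'a) \<Rightarrow> (nat \<Rightarrow> 'a)" where
  "vec_nat_mult R n k x = (\<lambda>i\<in>{..<n}. [k] \<cdot>\<^bsub>R\<^esub> x i)"

definition is_solution ::
    "('a, 'b) ring_scheme \<Rightarrow> nat \<Rightarrow> (nat \<Rightarrow> 'a) \<Rightarrow> (nat \<Rightarrow> 'a) \<Rightarrow> (nat \<Rightarrow> 'a) \<Rightarrow> (nat \<Rightarrow> 'a) \<Rightarrow> bool"
  where
  "is_solution R n x y z w \<longleftrightarrow> vec_add R n (vec_add R n x y) z = vec_nat_mult R n 3 w"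

definition trivial_solution :: "'v \<Rightarrow> 'v \<Rightarrow> 'v \<Rightarrow> 'v \<Rightarrow> bool" where
  "trivial_solution x y z w \<longleftrightarrow> x = y \<and> y = z \<and> z = w"

definition has_nontrivial_solution ::
    "('a, 'b) ring_scheme \<Rightarrow> nat \<Rightarrow> (nat \<Rightarrow> 'a) set \<Rightarrow> bool" where
  "has_nontrivial_solution R n A \<longleftrightarrow>
     (\<exists>x\<in>A. \<exists>y\<in>A. \<exists>z\<in>A. \<exists>w\<in>A. is_solution R n x y z w \<and> \<not> trivial_solution x y z w)"

end

theory Submission
  imports Defs "HOL-Computational_Algebra.Polynomial" "HOL-Analysis.Convex"
begin

text \<open>
  The slice rank method of Tao, after Croot--Lev--Pach and Ellenberg--Gijswijt, gives a bound which
  is exponential in \<open>n\<close> with a rate independent of \<open>q\<close>. On \<open>A\<close> the polynomial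
  \<open>\<Prod>\<^sub>i (1 - (x\<^sub>i + y\<^sub>i + z\<^sub>i - 3w\<^sub>i)^(q-1))\<close> is the indicator of \<open>x = y = z = w\<close>. Its degree is
  at most \<open>n(q-1)\<close>, so in each of its monomials one of the four points occurs with degree at most
  \<open>n(q-1)/4\<close>, which gives \<open>|A| \<le> 4m\<close> with \<open>m\<close> the number of such monomials in one point.
  An exponent vector uniform on \<open>{0,\<dots>,q-1}^n\<close> has mean degree \<open>n(q-1)/2\<close>, whence
  \<open>m \<le> q^n exp(-n/21)\<close> by a Chernoff bound. For small \<open>n\<close> the bound \<open>|A| \<le> q^n/2\<close> suffices.

  To compute with type-class sums and products, the field is presented as a quotient of
  \<open>\<int>[X]\<close>, sending \<open>X\<close> to a generator of the multiplicative group.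
\<close>

section \<open>Expansion of the indicator polynomial into monomials\<close>

definition eval_monom :: "nat \<Rightarrow> (nat \<Rightarrow> nat) \<Rightarrow> (nat \<Rightarrow> 'r::comm_monoid_mult) \<Rightarrow> 'r" where
  "eval_monom n e x = (\<Prod>i<n. x i ^ e i)"

text \<open>The factor 4 counts the points of a solution. It stands on the left so that the degree
  bound stays in the naturals.\<close>

definition low_exponents :: "nat \<Rightarrow> nat \<Rightarrow> (nat \<Rightarrow> nat) set" where
  "low_exponents q n = {e \<in> {..<n} \<rightarrow>\<^sub>E {..<q}. 4 * (\<Sum>i<n. e i) \<le> n * (q - 1)}"

lemma finite_low_exponents: "finite (low_exponents q n)"
  unfolding low_exponents_def by (rule finite_subset[of _ "{..<n} \<rightarrow>\<^sub>E {..<q}"]) (auto intro: finite_PiE)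

text \<open>The terms are indexed by \<open>None\<close> for the constant \<open>1\<close> and by \<open>Some g\<close> for the choice, in the
  \<open>j\<close>-th of the \<open>k\<close> factors, of the summand \<open>g j\<close>.\<close>

lemma one_minus_linear_form_power_expansion:
  fixes u :: "nat \<Rightarrow> 'r::comm_ring_1"
  obtains I :: "(nat \<Rightarrow> nat) option set" and e cf where "finite I"
    "\<And>t. t \<in> I \<Longrightarrow> (\<Sum>s<m. e t s) \<le> k"
    "\<And>v. 1 - (\<Sum>s<m. u s * v s) ^ k = (\<Sum>t\<in>I. cf t * (\<Prod>s<m. v s ^ e t s))"
proof -
  define G where "G = {..<k} \<rightarrow>\<^sub>E {..<m}"
  define cf where "cf = (\<lambda>t. case t of None \<Rightarrow> 1 | Some g \<Rightarrow> - (\<Prod>j<k. u (g j)))"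
  define e where
    "e = (\<lambda>t (s::nat). case t of None \<Rightarrow> 0 | Some g \<Rightarrow> card {j. j \<in> {..<k} \<and> g j = s})"
  have fin: "finite G" unfolding G_def by (rule finite_PiE) auto
  have img: "g ` {..<k} \<subseteq> {..<m}" if "g \<in> G" for g using that by (auto simp: G_def)
  have e_sum: "(\<Sum>s<m. e (Some g) s) = k" if "g \<in> G" for g
    using sum.group[OF _ _ img[OF that], of "\<lambda>_. 1::nat"] by (simp add: e_def)
  have monom: "(\<Prod>s<m. v s ^ e (Some g) s) = (\<Prod>j<k. v (g j))" if "g \<in> G" for g and v :: "nat \<Rightarrow> 'r"
  proof -
    have "(\<Prod>j | j \<in> {..<k} \<and> g j = s. v (g j)) = v s ^ e (Some g) s" for s
      by (simp add: e_def)
    then show ?thesis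
      using prod.group[OF _ _ img[OF that], of "\<lambda>j. v (g j)"] by simp
  qed
  show ?thesis
  proof
    show "finite (insert None (Some ` G))" using fin by simp
    show "(\<Sum>s<m. e t s) \<le> k" if "t \<in> insert None (Some ` G)" for t
      using that e_sum by (auto simp: e_def)
    fix v :: "nat \<Rightarrow> 'r"
    have "(\<Sum>s<m. u s * v s) ^ k = (\<Prod>j<k. \<Sum>s<m. u s * v s)" by simp
    also have "\<dots> = (\<Sum>g\<in>G. \<Prod>j<k. u (g j) * v (g j))"
      unfolding G_def by (rule prod_sum_PiE) auto
    also have "\<dots> = - (\<Sum>g\<in>G. cf (Some g) * (\<Prod>s<m. v s ^ e (Some g) s))"
      by (simp add: monom cf_def prod.distrib sum_negf)
    finally show "1 - (\<Sum>s<m. u s * v s) ^ k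
        = (\<Sum>t\<in>insert None (Some ` G). cf t * (\<Prod>s<m. v s ^ e t s))"
      using fin by (simp add: sum.reindex cf_def e_def)
  qed
qed

text \<open>Distributing the product lets \<gamma> choose one term of the preceding expansion for
  every coordinate. Each chosen term has degree at most \<open>k\<close>, so the \<open>m\<close>
  points share a total degree of at most \<open>n * k\<close>, and by averaging one of them carries
  at most an \<open>m\<close>-th of it.\<close>

lemma prod_one_minus_linear_form_power_expansion:
  fixes u :: "nat \<Rightarrow> 'r::comm_ring_1"
  assumes m: "m > 0"
  obtains \<Gamma> :: "(nat \<Rightarrow> (nat \<Rightarrow> nat) option) set" and E C where "finite \<Gamma>"
    "\<And>\<gamma> s. \<gamma> \<in> \<Gamma> \<Longrightarrow> s < m \<Longrightarrow> E \<gamma> s \<in> {..<n} \<rightarrow>\<^sub>E {..k}"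
    "\<And>\<gamma>. \<gamma> \<in> \<Gamma> \<Longrightarrow> \<exists>s<m. m * (\<Sum>i<n. E \<gamma> s i) \<le> n * k"
    "\<And>v. (\<Prod>i<n. 1 - (\<Sum>s<m. u s * v s i) ^ k)
        = (\<Sum>\<gamma>\<in>\<Gamma>. C \<gamma> * (\<Prod>s<m. eval_monom n (E \<gamma> s) (v s)))"
proof -
  obtain I :: "(nat \<Rightarrow> nat) option set" and e cf where I: "finite I"
    "\<And>t. t \<in> I \<Longrightarrow> (\<Sum>s<m. e t s) \<le> k"
    "\<And>v. 1 - (\<Sum>s<m. u s * v s) ^ k = (\<Sum>t\<in>I. cf t * (\<Prod>s<m. v s ^ e t s))"
    by (rule one_minus_linear_form_power_expansion[of m k u]) (rule that)
  define \<Gamma> where "\<Gamma> = {..<n} \<rightarrow>\<^sub>E I"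
  define E where "E = (\<lambda>\<gamma> s. \<lambda>i\<in>{..<n}. e (\<gamma> i) s)"
  have mem: "\<gamma> i \<in> I" if "\<gamma> \<in> \<Gamma>" "i < n" for \<gamma> i using that by (auto simp: \<Gamma>_def)
  show ?thesis
  proof
    show "finite \<Gamma>" unfolding \<Gamma>_def using I(1) by (intro finite_PiE) auto
    show "E \<gamma> s \<in> {..<n} \<rightarrow>\<^sub>E {..k}" if "\<gamma> \<in> \<Gamma>" "s < m" for \<gamma> s
    proof -
      have "e (\<gamma> i) s \<le> k" if "i < n" for i
        using member_le_sum[of s "{..<m}" "e (\<gamma> i)"] I(2)[OF mem[OF \<open>\<gamma> \<in> \<Gamma>\<close> that]] \<open>s < m\<close>
        by simp
      then show ?thesis by (auto simp: E_def)
    qed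
    show "\<exists>s<m. m * (\<Sum>i<n. E \<gamma> s i) \<le> n * k" if "\<gamma> \<in> \<Gamma>" for \<gamma>
    proof (rule ccontr)
      assume "\<not> ?thesis"
      then have "(\<Sum>s<m. n * k) < (\<Sum>s<m. m * (\<Sum>i<n. E \<gamma> s i))"
        using m by (intro sum_strict_mono) auto
      also have "\<dots> = m * (\<Sum>i<n. \<Sum>s<m. E \<gamma> s i)"
        by (subst sum.swap) (simp add: sum_distrib_left)
      also have "\<dots> \<le> m * (\<Sum>i<n. k)"
        using I(2) mem[OF that] by (intro mult_left_mono sum_mono) (auto simp: E_def)
      finally show False by simp
    qed
    fix v :: "nat \<Rightarrow> nat \<Rightarrow> 'r"
    have "(\<Prod>i<n. 1 - (\<Sum>s<m. u s * v s i) ^ k)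
        = (\<Prod>i<n. \<Sum>t\<in>I. cf t * (\<Prod>s<m. v s i ^ e t s))"
      by (simp only: I(3))
    also have "\<dots> = (\<Sum>\<gamma>\<in>\<Gamma>. \<Prod>i<n. cf (\<gamma> i) * (\<Prod>s<m. v s i ^ e (\<gamma> i) s))"
      unfolding \<Gamma>_def by (rule prod_sum_PiE) (use I(1) in auto)
    also have "\<dots> = (\<Sum>\<gamma>\<in>\<Gamma>. (\<Prod>i<n. cf (\<gamma> i)) * (\<Prod>s<m. eval_monom n (E \<gamma> s) (v s)))"
    proof (rule sum.cong[OF refl])
      fix \<gamma>
      have "(\<Prod>s<m. eval_monom n (E \<gamma> s) (v s)) = (\<Prod>i<n. \<Prod>s<m. v s i ^ e (\<gamma> i) s)"
        unfolding eval_monom_def E_def by (subst prod.swap) simp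
      then show "(\<Prod>i<n. cf (\<gamma> i) * (\<Prod>s<m. v s i ^ e (\<gamma> i) s))
          = (\<Prod>i<n. cf (\<gamma> i)) * (\<Prod>s<m. eval_monom n (E \<gamma> s) (v s))"
        by (simp add: prod.distrib)
    qed
    finally show "(\<Prod>i<n. 1 - (\<Sum>s<m. u s * v s i) ^ k)
        = (\<Sum>\<gamma>\<in>\<Gamma>. (\<Prod>i<n. cf (\<gamma> i)) * (\<Prod>s<m. eval_monom n (E \<gamma> s) (v s)))" .
  qed
qed

text \<open>This separates the variables: for each monomial of the expanded polynomial, the weighted
  sum over triples becomes a product of three moments.\<close>

lemma sum_product_triple:
  fixes a b c :: "'v \<Rightarrow> 'r::comm_ring_1"
  shows "(\<Sum>(x, y, z)\<in>A \<times> A \<times> A. a x * b y * c z) = sum a A * sum b A * sum c A"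
proof -
  have "sum a A * sum b A * sum c A = (\<Sum>x\<in>A. \<Sum>y\<in>A. \<Sum>z\<in>A. a x * b y * c z)"
    unfolding mult.assoc unfolding sum_product[of b A c A]
    unfolding sum_distrib_right[of a A] unfolding sum_distrib_left by (rule refl)
  then show ?thesis by (simp add: sum.cartesian_product)
qed

section \<open>Slice rank over a finite residue field\<close>

text \<open>\<open>K\<close> is an ideal and \<phi> labels its residue classes by elements of an
  arbitrary type, so equations in the residue field become congruences modulo \<open>K\<close>. The
  field structure enters through \<open>fermat\<close>.\<close>

locale finite_residue_field =
  fixes K :: "'r::comm_ring_1 set" and \<phi> :: "'r \<Rightarrow> 'a" and q :: nat
  assumes add_mem: "a \<in> K \<Longrightarrow> b \<in> K \<Longrightarrow> a + b \<in> K"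
    and mult_mem: "a \<in> K \<Longrightarrow> r * a \<in> K"
    and zero_mem: "0 \<in> K"
    and one_notin: "1 \<notin> K"
    and phi_eq_iff: "\<phi> a = \<phi> b \<longleftrightarrow> a - b \<in> K"
    and finite_range: "finite (range \<phi>)"
    and card_range: "card (range \<phi>) = q"
    and fermat: "a \<notin> K \<Longrightarrow> a ^ (q - 1) - 1 \<in> K"
begin

lemma mult_mem_left: "a \<in> K \<Longrightarrow> a * r \<in> K"
  using mult_mem[of a r] by (simp add: mult.commute)

lemma uminus_mem: "a \<in> K \<Longrightarrow> - a \<in> K"
  using mult_mem[of a "-1"] by simp

lemma diff_mem: "a \<in> K \<Longrightarrow> b \<in> K \<Longrightarrow> a - b \<in> K"
  using add_mem[OF _ uminus_mem, of a b] by simp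

lemma sum_mem: "(\<And>i. i \<in> I \<Longrightarrow> f i \<in> K) \<Longrightarrow> sum f I \<in> K"
  by (induction I rule: infinite_finite_induct) (auto simp: zero_mem add_mem)

lemma mem_iff_if_diff_mem: "a - b \<in> K \<Longrightarrow> a \<in> K \<longleftrightarrow> b \<in> K"
  using add_mem[of "a - b" b] diff_mem[of a "a - b"] by auto

lemma q_ge_2: "q \<ge> 2"
proof -
  have "\<phi> 0 \<noteq> \<phi> 1"
    using phi_eq_iff[of 0 1] uminus_mem[of "-1"] one_notin by auto
  then have "card {\<phi> 0, \<phi> 1} = 2" by simp
  moreover have "card {\<phi> 0, \<phi> 1} \<le> card (range \<phi>)"
    by (rule card_mono[OF finite_range]) auto
  ultimately show ?thesis using card_range by simp
qed

text \<open>\<open>K\<close> is prime: by \<open>fermat\<close> the power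
  \<open>(a * b) ^ (q - 1)\<close> is congruent to 1, whereas \<open>a * b\<close> in
  \<open>K\<close> would put it into \<open>K\<close>, the exponent being positive.\<close>

lemma mult_notin:
  assumes "a \<notin> K" "b \<notin> K"
  shows "a * b \<notin> K"
proof
  assume ab: "a * b \<in> K"
  have k: "q - 1 = Suc (q - 2)" using q_ge_2 by simp
  have "(a * b) ^ (q - 1) \<in> K"
    unfolding k power_Suc by (rule mult_mem_left[OF ab])
  then have "a ^ (q - 1) * b ^ (q - 1) \<in> K" by (simp add: power_mult_distrib)
  moreover have eq: "a ^ (q - 1) * b ^ (q - 1) - 1
      = b ^ (q - 1) * (a ^ (q - 1) - 1) + (b ^ (q - 1) - 1)"
    by (simp add: algebra_simps)
  have "a ^ (q - 1) * b ^ (q - 1) - 1 \<in> K"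
    unfolding eq by (intro add_mem mult_mem fermat assms)
  ultimately show False
    using mem_iff_if_diff_mem one_notin by blast
qed

text \<open>Counting replaces linear algebra: there are more residue vectors on \<open>S\<close>
  than value vectors on \<open>J\<close>, so two of them have the same values, and their difference
  solves the system.\<close>

lemma homogeneous_system_nontrivial_solution:
  fixes f :: "'j \<Rightarrow> 'v \<Rightarrow> 'r"
  assumes S: "finite S" and J: "finite J" and less: "card J < card S"
  obtains h where "\<And>x. x \<notin> S \<Longrightarrow> h x = 0" "\<exists>x\<in>S. h x \<notin> K"
    "\<And>j. j \<in> J \<Longrightarrow> (\<Sum>x\<in>S. h x * f j x) \<in> K"
proof -
  \<comment> \<open>A choice of a representative in the ring for each residue class.\<close>
  define \<sigma> where "\<sigma> = inv_into UNIV \<phi>"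
  have \<sigma>: "\<phi> (\<sigma> a) = a" if "a \<in> range \<phi>" for a
    using that unfolding \<sigma>_def by (rule f_inv_into_f)
  define L where "L u = (\<lambda>j\<in>J. \<phi> (\<Sum>x\<in>S. \<sigma> (u x) * f j x))" for u
  have card_dom: "card (S \<rightarrow>\<^sub>E range \<phi>) = q ^ card S"
    using S card_range by (simp add: card_PiE)
  have card_cod: "card (J \<rightarrow>\<^sub>E range \<phi>) = q ^ card J"
    using J card_range by (simp add: card_PiE)
  have "card (L ` (S \<rightarrow>\<^sub>E range \<phi>)) \<le> card (J \<rightarrow>\<^sub>E range \<phi>)"
    by (rule card_mono) (auto simp: L_def J finite_range intro!: finite_PiE)
  also have "\<dots> < card (S \<rightarrow>\<^sub>E range \<phi>)"
    unfolding card_dom card_cod using q_ge_2 less by (intro power_strict_increasing) auto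
  finally have "\<not> inj_on L (S \<rightarrow>\<^sub>E range \<phi>)"
    using card_image by fastforce
  then obtain u u' where u: "u \<in> S \<rightarrow>\<^sub>E range \<phi>" "u' \<in> S \<rightarrow>\<^sub>E range \<phi>"
    and Lu: "L u = L u'" and neq: "u \<noteq> u'"
    unfolding inj_on_def by blast
  obtain x where x: "x \<in> S" "u x \<noteq> u' x"
    using neq PiE_ext[OF u] by blast
  define h where "h = (\<lambda>x. if x \<in> S then \<sigma> (u x) - \<sigma> (u' x) else 0)"
  show ?thesis
  proof
    show "h x = 0" if "x \<notin> S" for x using that by (simp add: h_def)
    have "\<phi> (\<sigma> (u x)) \<noteq> \<phi> (\<sigma> (u' x))"
      using x \<sigma>[OF PiE_mem[OF u(1) x(1)]] \<sigma>[OF PiE_mem[OF u(2) x(1)]] by simp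
    then show "\<exists>x\<in>S. h x \<notin> K"
      using x phi_eq_iff by (auto simp: h_def)
    fix j assume j: "j \<in> J"
    have "\<phi> (\<Sum>x\<in>S. \<sigma> (u x) * f j x) = \<phi> (\<Sum>x\<in>S. \<sigma> (u' x) * f j x)"
      using fun_cong[OF Lu, of j] j by (simp add: L_def)
    then show "(\<Sum>x\<in>S. h x * f j x) \<in> K"
      unfolding phi_eq_iff by (simp add: h_def sum_subtractf algebra_simps)
  qed
qed

text \<open>In a solution of maximal support, at most \<open>card J\<close> points lie outside the support:
  otherwise a nontrivial solution living off the support could be added.\<close>

lemma homogeneous_system_large_support:
  fixes f :: "'j \<Rightarrow> 'v \<Rightarrow> 'r"
  assumes S: "finite S" and J: "finite J"
  obtains h where "\<And>x. x \<notin> S \<Longrightarrow> h x = 0" "card S \<le> card {x \<in> S. h x \<notin> K} + card J"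
    "\<And>j. j \<in> J \<Longrightarrow> (\<Sum>x\<in>S. h x * f j x) \<in> K"
proof -
  define sol where
    "sol h \<longleftrightarrow> (\<forall>x. x \<notin> S \<longrightarrow> h x = 0) \<and> (\<forall>j\<in>J. (\<Sum>x\<in>S. h x * f j x) \<in> K)" for h
  define supp where "supp h = {x \<in> S. h x \<notin> K}" for h
  have bound: "card (supp h) \<le> card S" for h
    unfolding supp_def by (rule card_mono[OF S]) auto
  have "sol (\<lambda>_. 0)" by (simp add: sol_def zero_mem)
  then obtain h where h: "sol h" and max: "\<And>g. sol g \<Longrightarrow> card (supp g) \<le> card (supp h)"
    using ex_has_greatest_nat[of sol "\<lambda>_. 0" "\<lambda>h. card (supp h)" "Suc (card S)"] bound
    by (metis less_Suc_eq_le)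
  have "card S \<le> card (supp h) + card J"
  proof (rule ccontr)
    assume "\<not> ?thesis"
    then have "card J < card (S - supp h)"
      using card_Diff_subset[of "supp h" S] S by (simp add: supp_def)
    then obtain g where g: "\<And>x. x \<notin> S - supp h \<Longrightarrow> g x = 0" "\<exists>x\<in>S - supp h. g x \<notin> K"
      "\<And>j. j \<in> J \<Longrightarrow> (\<Sum>x\<in>S - supp h. g x * f j x) \<in> K"
      using homogeneous_system_nontrivial_solution[of "S - supp h" J f] S J by blast
    obtain y where y: "y \<in> S - supp h" "g y \<notin> K" using g(2) by blast
    have "(\<Sum>x\<in>S. g x * f j x) = (\<Sum>x\<in>S - supp h. g x * f j x)" for j
      by (rule sum.mono_neutral_right) (use S g(1) in auto)
    then have "sol (\<lambda>x. h x + g x)"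
      using h g(1,3) by (auto simp: sol_def distrib_right sum.distrib add_mem)
    \<comment> \<open>On the old support \<open>g\<close> is exactly 0, so nothing is lost there. At
      \<open>y\<close> the value of \<open>h\<close> lies in \<open>K\<close>, so the sum is
      congruent to \<open>g y\<close>.\<close>
    moreover have "insert y (supp h) \<subseteq> supp (\<lambda>x. h x + g x)"
    proof -
      have "h x + g x \<notin> K" if "x \<in> supp h" for x
        using that g(1)[of x] by (simp add: supp_def)
      moreover have "h y \<in> K" using y(1) by (simp add: supp_def)
      then have "h y + g y \<notin> K"
        using mem_iff_if_diff_mem[of "h y + g y" "g y"] y(2) by simp
      ultimately show ?thesis using y(1) by (auto simp: supp_def)
    qed
    then have "card (insert y (supp h)) \<le> card (supp (\<lambda>x. h x + g x))"
      by (rule card_mono[rotated]) (use S in \<open>simp add: supp_def\<close>)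
    moreover have "card (insert y (supp h)) = Suc (card (supp h))"
      using y(1) S by (simp add: supp_def)
    ultimately show False using max by fastforce
  qed
  then show ?thesis using that[of h] h by (simp add: sol_def supp_def)
qed

text \<open>Sum the indicator polynomial over \<open>x, y, z\<close> against weights \<open>h1, h2, h3\<close>. Those for \<open>x\<close> and
  \<open>y\<close> kill all low monomials while keeping a large support; if \<open>card A\<close> were too big, \<open>h3\<close> could
  be chosen nonzero on that support so as to kill also the coefficients \<open>G b\<close> of the low monomials
  in \<open>w\<close>. The result would be both zero and equal to \<open>h1 w * h2 w * h3 w\<close>.\<close>

theorem card_le_if_only_trivial_solutions:
  fixes pt :: "'v \<Rightarrow> nat \<Rightarrow> 'r"
  assumes A: "finite A"
    and sol: "\<And>x y z w. x \<in> A \<Longrightarrow> y \<in> A \<Longrightarrow> z \<in> A \<Longrightarrow> w \<in> A \<Longrightarrow>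
      (\<forall>i<n. pt x i + pt y i + pt z i - 3 * pt w i \<in> K) \<Longrightarrow> x = y \<and> y = z \<and> z = w"
  shows "card A \<le> 4 * card (low_exponents q n)"
proof -
  define L where "L = low_exponents q n"
  have L: "finite L" unfolding L_def by (rule finite_low_exponents)
  define mon where "mon e x = eval_monom n e (pt x)" for e x
  define P where
    "P x y z w = (\<Prod>i<n. 1 - (pt x i + pt y i + pt z i - 3 * pt w i) ^ (q - 1))" for x y z w
  \<comment> \<open>The slots 0, 1, 2, 3 hold the points x, y, z, w.\<close>
  define u :: "nat \<Rightarrow> 'r" where "u s = (if s = 3 then - 3 else 1)" for s
  obtain \<Gamma> :: "(nat \<Rightarrow> (nat \<Rightarrow> nat) option) set" and E C where \<Gamma>: "finite \<Gamma>"
    and E_mem: "\<And>\<gamma> s. \<gamma> \<in> \<Gamma> \<Longrightarrow> s < 4 \<Longrightarrow> E \<gamma> s \<in> {..<n} \<rightarrow>\<^sub>E {..q - 1}"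
    and E_low: "\<And>\<gamma>. \<gamma> \<in> \<Gamma> \<Longrightarrow> \<exists>s<4. 4 * (\<Sum>i<n. E \<gamma> s i) \<le> n * (q - 1)"
    and expand: "\<And>v. (\<Prod>i<n. 1 - (\<Sum>s<4. u s * v s i) ^ (q - 1))
        = (\<Sum>\<gamma>\<in>\<Gamma>. C \<gamma> * (\<Prod>s<4. eval_monom n (E \<gamma> s) (v s)))"
    by (rule prod_one_minus_linear_form_power_expansion[of 4 n "q - 1" u, OF zero_less_numeral]) (rule that)
  have P_expand: "P x y z w
      = (\<Sum>\<gamma>\<in>\<Gamma>. C \<gamma> * mon (E \<gamma> 0) x * mon (E \<gamma> 1) y * mon (E \<gamma> 2) z * mon (E \<gamma> 3) w)"
    for x y z w
    using expand[of "\<lambda>s. pt ([x, y, z, w] ! s)"]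
    by (simp add: P_def mon_def u_def eval_nat_numeral mult.assoc)
  have low: "\<exists>s<4. E \<gamma> s \<in> L" if g: "\<gamma> \<in> \<Gamma>" for \<gamma>
  proof -
    obtain s where s: "s < 4" "4 * (\<Sum>i<n. E \<gamma> s i) \<le> n * (q - 1)"
      using E_low[OF g] by blast
    have "{..q - 1} = {..<q}" using q_ge_2 by auto
    then have "E \<gamma> s \<in> L" using E_mem[OF g s(1)] s(2) by (simp add: L_def low_exponents_def)
    then show ?thesis using s(1) by blast
  qed
  have P_diag: "P w w w w = 1" for w
    using q_ge_2 by (simp add: P_def power_0_left)
  have P_off: "P x y z w \<in> K"
    if xyzw: "x \<in> A" "y \<in> A" "z \<in> A" "w \<in> A" "(x, y, z) \<noteq> (w, w, w)" for x y z w
  proof -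
    obtain i where i: "i < n" "pt x i + pt y i + pt z i - 3 * pt w i \<notin> K"
      using sol[OF xyzw(1-4)] xyzw(5) by blast
    have "1 - (pt x i + pt y i + pt z i - 3 * pt w i) ^ (q - 1) \<in> K"
      using uminus_mem[OF fermat[OF i(2)]] by simp
    then show ?thesis
      unfolding P_def using i(1) by (subst prod.remove[of _ i]) (auto intro: mult_mem_left)
  qed
  obtain h1 where h1: "\<And>x. x \<notin> A \<Longrightarrow> h1 x = 0"
    "card A \<le> card {x \<in> A. h1 x \<notin> K} + card L"
    "\<And>e. e \<in> L \<Longrightarrow> (\<Sum>x\<in>A. h1 x * mon e x) \<in> K"
    by (rule homogeneous_system_large_support[OF A L, of mon]) (rule that)
  \<comment> \<open>The second weight will live on the support of the first, so that both are
    nonzero modulo \<open>K\<close> on \<open>T2\<close>.\<close>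
  define T1 where "T1 = {x \<in> A. h1 x \<notin> K}"
  have T1: "finite T1" "T1 \<subseteq> A" using A by (auto simp: T1_def)
  obtain h2 where h2: "\<And>x. x \<notin> T1 \<Longrightarrow> h2 x = 0"
    "card T1 \<le> card {x \<in> T1. h2 x \<notin> K} + card L"
    "\<And>e. e \<in> L \<Longrightarrow> (\<Sum>x\<in>T1. h2 x * mon e x) \<in> K"
    by (rule homogeneous_system_large_support[OF T1(1) L, of mon]) (rule that)
  have h2': "(\<Sum>x\<in>A. h2 x * mon e x) \<in> K" if "e \<in> L" for e
    using h2(3)[OF that] h2(1) sum.mono_neutral_right[OF A T1(2), of "\<lambda>x. h2 x * mon e x"] by simp
  define T2 where "T2 = {x \<in> T1. h2 x \<notin> K}"
  have T2: "finite T2" "T2 \<subseteq> A" using T1 by (auto simp: T2_def)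
  define M1 where "M1 \<gamma> = (\<Sum>x\<in>A. h1 x * mon (E \<gamma> 0) x)" for \<gamma>
  define M2 where "M2 \<gamma> = (\<Sum>x\<in>A. h2 x * mon (E \<gamma> 1) x)" for \<gamma>
  \<comment> \<open>The terms not annihilated by making the weights orthogonal to low monomials in
    x, y and z. In these the low exponent can only be that of w.\<close>
  define \<Gamma>' where "\<Gamma>' = {\<gamma> \<in> \<Gamma>. E \<gamma> 0 \<notin> L \<and> E \<gamma> 1 \<notin> L \<and> E \<gamma> 2 \<notin> L}"
  have \<Gamma>': "finite \<Gamma>'" "\<Gamma>' \<subseteq> \<Gamma>" using \<Gamma> by (auto simp: \<Gamma>'_def)
  have E3: "E \<gamma> 3 \<in> L" if g: "\<gamma> \<in> \<Gamma>'" for \<gamma>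
  proof -
    obtain s where "s < 4" "E \<gamma> s \<in> L" using low g by (auto simp: \<Gamma>'_def)
    moreover from \<open>s < 4\<close> have "s = 0 \<or> s = 1 \<or> s = 2 \<or> s = 3" by linarith
    ultimately show ?thesis using g unfolding \<Gamma>'_def by blast
  qed
  define G where
    "G b z = (\<Sum>\<gamma> | \<gamma> \<in> \<Gamma>' \<and> E \<gamma> 3 = b. C \<gamma> * M1 \<gamma> * M2 \<gamma> * mon (E \<gamma> 2) z)" for b z
  have "card T2 \<le> 2 * card L"
  proof (rule ccontr)
    assume "\<not> ?thesis"
    \<comment> \<open>The left copy of \<open>L\<close> indexes the conditions that kill low
      monomials in z, the right copy those that kill the coefficients \<open>G b\<close>.\<close>
    then have less: "card (L <+> L) < card T2" using L by (simp add: card_Plus)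
    have fin: "finite (L <+> L)" using L by simp
    obtain h3 where h3: "\<And>x. x \<notin> T2 \<Longrightarrow> h3 x = 0" "\<exists>x\<in>T2. h3 x \<notin> K"
      "\<And>j. j \<in> L <+> L \<Longrightarrow> (\<Sum>x\<in>T2. h3 x * (case j of Inl e \<Rightarrow> mon e x | Inr b \<Rightarrow> G b x)) \<in> K"
      by (rule homogeneous_system_nontrivial_solution
        [OF T2(1) fin less, of "\<lambda>j x. case j of Inl e \<Rightarrow> mon e x | Inr b \<Rightarrow> G b x"]) (rule that)
    have ext: "(\<Sum>x\<in>A. h3 x * f x) = (\<Sum>x\<in>T2. h3 x * f x)" for f
      using h3(1) by (intro sum.mono_neutral_right A T2) auto
    have h3_mon: "(\<Sum>x\<in>A. h3 x * mon e x) \<in> K" if "e \<in> L" for e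
      using h3(3)[of "Inl e"] that ext by auto
    have h3_G: "(\<Sum>x\<in>A. h3 x * G b x) \<in> K" if "b \<in> L" for b
      using h3(3)[of "Inr b"] that ext by auto
    define M3 where "M3 \<gamma> = (\<Sum>x\<in>A. h3 x * mon (E \<gamma> 2) x)" for \<gamma>
    obtain w where w: "w \<in> T2" "h3 w \<notin> K" using h3(2) by blast
    have wA: "w \<in> A" using w(1) T2 by auto
    define \<Phi> where "\<Phi> = (\<Sum>(x, y, z)\<in>A \<times> A \<times> A. h1 x * h2 y * h3 z * P x y z w)"
    \<comment> \<open>Modulo \<open>K\<close> only the triple \<open>(w, w, w)\<close> contributes,
      and there \<open>P\<close> is 1.\<close>
    have "\<Phi> - h1 w * h2 w * h3 w
        = (\<Sum>(x, y, z)\<in>A \<times> A \<times> A - {(w, w, w)}. h1 x * h2 y * h3 z * P x y z w)"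
      unfolding \<Phi>_def using A wA by (subst sum.remove[of _ "(w, w, w)"]) (auto simp: P_diag)
    also have "\<dots> \<in> K"
      using wA by (intro sum_mem) (auto intro!: mult_mem P_off)
    finally have diff: "\<Phi> - h1 w * h2 w * h3 w \<in> K" .
    have "\<Phi> = (\<Sum>(x, y, z)\<in>A \<times> A \<times> A. \<Sum>\<gamma>\<in>\<Gamma>. C \<gamma> * mon (E \<gamma> 3) w *
        ((h1 x * mon (E \<gamma> 0) x) * (h2 y * mon (E \<gamma> 1) y) * (h3 z * mon (E \<gamma> 2) z)))"
      unfolding \<Phi>_def P_expand by (simp add: sum_distrib_left mult_ac)
    also have "\<dots> = (\<Sum>\<gamma>\<in>\<Gamma>. C \<gamma> * mon (E \<gamma> 3) w *
        (\<Sum>(x, y, z)\<in>A \<times> A \<times> A.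
          (h1 x * mon (E \<gamma> 0) x) * (h2 y * mon (E \<gamma> 1) y) * (h3 z * mon (E \<gamma> 2) z)))"
      unfolding sum_distrib_left case_prod_unfold by (rule sum.swap)
    also have "\<dots> = (\<Sum>\<gamma>\<in>\<Gamma>. C \<gamma> * mon (E \<gamma> 3) w * (M1 \<gamma> * M2 \<gamma> * M3 \<gamma>))"
      unfolding sum_product_triple M1_def M2_def M3_def ..
    also have "\<dots> = (\<Sum>\<gamma>\<in>\<Gamma> - \<Gamma>'. C \<gamma> * mon (E \<gamma> 3) w * (M1 \<gamma> * M2 \<gamma> * M3 \<gamma>))
        + (\<Sum>\<gamma>\<in>\<Gamma>'. C \<gamma> * mon (E \<gamma> 3) w * (M1 \<gamma> * M2 \<gamma> * M3 \<gamma>))"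
      by (rule sum.subset_diff[OF \<Gamma>'(2) \<Gamma>])
    also have "\<dots> \<in> K"
    proof (rule add_mem)
      show "(\<Sum>\<gamma>\<in>\<Gamma> - \<Gamma>'. C \<gamma> * mon (E \<gamma> 3) w * (M1 \<gamma> * M2 \<gamma> * M3 \<gamma>)) \<in> K"
      proof (rule sum_mem)
        fix \<gamma> assume "\<gamma> \<in> \<Gamma> - \<Gamma>'"
        then have "E \<gamma> 0 \<in> L \<or> E \<gamma> 1 \<in> L \<or> E \<gamma> 2 \<in> L" by (auto simp: \<Gamma>'_def)
        then have "M1 \<gamma> \<in> K \<or> M2 \<gamma> \<in> K \<or> M3 \<gamma> \<in> K"
          unfolding M1_def M2_def M3_def using h1(3) h2' h3_mon by blast
        then show "C \<gamma> * mon (E \<gamma> 3) w * (M1 \<gamma> * M2 \<gamma> * M3 \<gamma>) \<in> K"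
          by (auto intro: mult_mem mult_mem_left)
      qed
      \<comment> \<open>Grouping by the exponent of w turns the remaining terms into the sums that
        the second family of conditions on \<open>h3\<close> puts into \<open>K\<close>.\<close>
      have "(\<Sum>\<gamma>\<in>\<Gamma>'. C \<gamma> * mon (E \<gamma> 3) w * (M1 \<gamma> * M2 \<gamma> * M3 \<gamma>))
          = (\<Sum>b\<in>L. \<Sum>\<gamma> | \<gamma> \<in> \<Gamma>' \<and> E \<gamma> 3 = b. C \<gamma> * mon (E \<gamma> 3) w * (M1 \<gamma> * M2 \<gamma> * M3 \<gamma>))"
        using E3 by (intro sum.group[symmetric] \<Gamma>' L) auto
      also have "\<dots> = (\<Sum>b\<in>L. mon b w * (\<Sum>z\<in>A. h3 z * G b z))"
      proof (rule sum.cong[OF refl])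
        fix b
        have "mon b w * (\<Sum>z\<in>A. h3 z * G b z) = (\<Sum>z\<in>A. \<Sum>\<gamma> | \<gamma> \<in> \<Gamma>' \<and> E \<gamma> 3 = b.
            C \<gamma> * mon (E \<gamma> 3) w * (M1 \<gamma> * M2 \<gamma> * (h3 z * mon (E \<gamma> 2) z)))"
          unfolding G_def sum_distrib_left by (intro sum.cong refl) (auto simp: mult_ac)
        also have "\<dots> = (\<Sum>\<gamma> | \<gamma> \<in> \<Gamma>' \<and> E \<gamma> 3 = b. C \<gamma> * mon (E \<gamma> 3) w * (M1 \<gamma> * M2 \<gamma> * M3 \<gamma>))"
          unfolding M3_def sum_distrib_left by (rule sum.swap)
        finally show "(\<Sum>\<gamma> | \<gamma> \<in> \<Gamma>' \<and> E \<gamma> 3 = b. C \<gamma> * mon (E \<gamma> 3) w * (M1 \<gamma> * M2 \<gamma> * M3 \<gamma>))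
            = mon b w * (\<Sum>z\<in>A. h3 z * G b z)" by simp
      qed
      also have "\<dots> \<in> K" by (intro sum_mem mult_mem h3_G)
      finally show "(\<Sum>\<gamma>\<in>\<Gamma>'. C \<gamma> * mon (E \<gamma> 3) w * (M1 \<gamma> * M2 \<gamma> * M3 \<gamma>)) \<in> K" .
    qed
    finally have "h1 w * h2 w * h3 w \<in> K" using mem_iff_if_diff_mem[OF diff] by blast
    then show False using w mult_notin by (auto simp: T1_def T2_def)
  qed
  \<comment> \<open>Each of the two passages to a support loses at most \<open>card L\<close>
    points, and at most \<open>2 * card L\<close> are left.\<close>
  then show ?thesis
    using h1(2) h2(2) unfolding T1_def[symmetric] T2_def[symmetric] L_def[symmetric] by linarith
qed

end

section \<open>Finite fields as quotients of the integer polynomials\<close>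

text \<open>Horner's rule for the homomorphism from the integer polynomials that sends X to
  \<open>g\<close>.\<close>

definition int_poly_eval :: "('a, 'b) ring_scheme \<Rightarrow> 'a \<Rightarrow> int poly \<Rightarrow> 'a" where
  "int_poly_eval R g p = fold_coeffs (\<lambda>a r. add_pow R a \<one>\<^bsub>R\<^esub> \<oplus>\<^bsub>R\<^esub> g \<otimes>\<^bsub>R\<^esub> r) p \<zero>\<^bsub>R\<^esub>"

context cring
begin

lemma add_pow_int_0 [simp]: "[(0::int)] \<cdot> a = \<zero>"
  by (simp add: add_pow_def)

lemma int_poly_eval_0 [simp]: "int_poly_eval R g 0 = \<zero>"
  by (simp add: int_poly_eval_def)

lemma int_poly_eval_pCons:
  assumes "g \<in> carrier R"
  shows "int_poly_eval R g (pCons a p) = [a] \<cdot> \<one> \<oplus> g \<otimes> int_poly_eval R g p"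
  \<comment> \<open>The case \<open>pCons 0 0 = 0\<close> is separate because
    \<open>fold_coeffs\<close> then performs no step.\<close>
  using assms by (cases "p = 0 \<and> a = 0") (auto simp: int_poly_eval_def)

lemma int_poly_eval_closed [simp]:
  assumes "g \<in> carrier R"
  shows "int_poly_eval R g p \<in> carrier R"
  using assms by (induction p) (auto simp: int_poly_eval_pCons)

lemma int_poly_eval_1 [simp]: "g \<in> carrier R \<Longrightarrow> int_poly_eval R g 1 = \<one>"
  by (simp add: one_pCons int_poly_eval_pCons)

lemma int_poly_eval_add:
  assumes g: "g \<in> carrier R"
  shows "int_poly_eval R g (p + p') = int_poly_eval R g p \<oplus> int_poly_eval R g p'"
proof (induction p p' rule: poly_induct2)
  case (pCons a p b p')
  then show ?case
    using g by (simp add: int_poly_eval_pCons add.int_pow_mult r_distr a_ac)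
qed simp

lemma int_poly_eval_uminus:
  assumes g: "g \<in> carrier R"
  shows "int_poly_eval R g (- p) = \<ominus> int_poly_eval R g p"
proof -
  have "int_poly_eval R g (- p) \<oplus> int_poly_eval R g p = \<zero>"
    using int_poly_eval_add[OF g, of "- p" p] by simp
  then show ?thesis using g by (simp add: sum_zero_eq_neg)
qed

lemma int_poly_eval_diff:
  assumes g: "g \<in> carrier R"
  shows "int_poly_eval R g (p - p') = int_poly_eval R g p \<ominus> int_poly_eval R g p'"
  using int_poly_eval_add[OF g, of p "- p'"] int_poly_eval_uminus[OF g]
  by (simp add: a_minus_def)

lemma int_poly_eval_smult:
  assumes g: "g \<in> carrier R"
  shows "int_poly_eval R g (smult a p) = [a] \<cdot> \<one> \<otimes> int_poly_eval R g p"
proof (induction p)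
  case (pCons b p)
  have "[(a * b)] \<cdot> \<one> = [a] \<cdot> \<one> \<otimes> [b] \<cdot> \<one>"
    by (simp add: add_pow_ldistr_int add.int_pow_pow mult.commute)
  then show ?case
    using g pCons.IH by (simp add: int_poly_eval_pCons r_distr m_lcomm)
qed (simp add: g)

lemma int_poly_eval_mult:
  assumes g: "g \<in> carrier R"
  shows "int_poly_eval R g (p * p') = int_poly_eval R g p \<otimes> int_poly_eval R g p'"
proof (induction p)
  case (pCons a p)
  then show ?case
    using g by (simp add: int_poly_eval_pCons int_poly_eval_add int_poly_eval_smult l_distr m_assoc)
qed (simp add: g)

lemma int_poly_eval_power:
  assumes g: "g \<in> carrier R"
  shows "int_poly_eval R g (p ^ k) = int_poly_eval R g p [^] k"
  using g by (induction k) (simp_all add: int_poly_eval_mult m_comm)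

end

context field
begin

text \<open>The multiplicative group of a finite field is cyclic. With \<open>g\<close> a generator,
  every nonzero element is the image of a power of X.\<close>

lemma ex_int_poly_eval_surj:
  assumes "finite (carrier R)"
  obtains g where "g \<in> carrier R" "range (int_poly_eval R g) = carrier R"
proof -
  obtain g where g: "g \<in> carrier (Multiplicative_Group.mult_of R)"
    and gen: "carrier (Multiplicative_Group.mult_of R) = {g [^] i | i::nat. i \<in> UNIV}"
    using finite_field_mult_group_has_gen[OF assms] by auto
  have gR: "g \<in> carrier R" using g by simp
  have "a \<in> range (int_poly_eval R g)" if "a \<in> carrier R" for a
  proof (cases "a = \<zero>")
    case True
    then show ?thesis using int_poly_eval_0 by (metis rangeI)
  next
    case False
    then have "a \<in> carrier (Multiplicative_Group.mult_of R)" using that by simp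
    then obtain i :: nat where "a = g [^] i" using gen by auto
    also have "g [^] i = int_poly_eval R g ([:0, 1:] ^ i)"
      using gR by (simp add: int_poly_eval_power int_poly_eval_pCons)
    finally show ?thesis by blast
  qed
  then show ?thesis using that gR by fastforce
qed

text \<open>The axiom \<open>fermat\<close> is Lagrange's theorem in the multiplicative group, whose
  order is \<open>card (carrier R) - 1\<close>.\<close>

lemma finite_residue_field_int_poly_eval:
  assumes fin: "finite (carrier R)" and g: "g \<in> carrier R"
    and surj: "range (int_poly_eval R g) = carrier R"
  shows "finite_residue_field {p. int_poly_eval R g p = \<zero>} (int_poly_eval R g) (card (carrier R))"
proof
  show "int_poly_eval R g a = int_poly_eval R g b \<longleftrightarrow> a - b \<in> {p. int_poly_eval R g p = \<zero>}" for a b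
    using g by (simp add: int_poly_eval_diff)
  fix a assume "a \<notin> {p. int_poly_eval R g p = \<zero>}"
  then have a: "int_poly_eval R g a \<in> carrier (Multiplicative_Group.mult_of R)" using g by simp
  interpret M: group "Multiplicative_Group.mult_of R" by (rule field_mult_group)
  have "int_poly_eval R g a [^] (card (carrier R) - 1) = \<one>"
    using M.pow_order_eq_1[OF a] fin
    by (simp add: order_mult_of Coset.order_def Multiplicative_Group.nat_pow_mult_of)
  then show "a ^ (card (carrier R) - 1) - 1 \<in> {p. int_poly_eval R g p = \<zero>}"
    using g by (simp add: int_poly_eval_diff int_poly_eval_power r_right_minus_eq)
qed (use fin g surj in \<open>auto simp: int_poly_eval_add int_poly_eval_mult\<close>)

section \<open>Two bounds for solution-free sets over a finite field\<close>

lemma card_coord_space: "card (coord_space R n) = card (carrier R) ^ n"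
  unfolding coord_space_def by (simp add: card_PiE)

lemma add_pow_3: "a \<in> carrier R \<Longrightarrow> [(3::nat)] \<cdot> a = a \<oplus> a \<oplus> a"
  by (simp add: numeral_3_eq_3 a_assoc)

text \<open>Lifting each coordinate to a polynomial that evaluates to it turns the equation in
  \<open>R\<close> into a congruence modulo the kernel, to which the slice rank bound
  applies.\<close>

theorem card_solution_free_le_low_exponents:
  assumes fin: "finite (carrier R)" and A: "A \<subseteq> coord_space R n"
    and free: "\<not> has_nontrivial_solution R n A"
  shows "card A \<le> 4 * card (low_exponents (card (carrier R)) n)"
proof -
  obtain g where g: "g \<in> carrier R" and surj: "range (int_poly_eval R g) = carrier R"
    using ex_int_poly_eval_surj[OF fin] .
  let ?\<phi> = "int_poly_eval R g"
  interpret frf: finite_residue_field "{p. ?\<phi> p = \<zero>}" ?\<phi> "card (carrier R)"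
    by (rule finite_residue_field_int_poly_eval[OF fin g surj])
  define pt where "pt x i = inv_into UNIV ?\<phi> (x i)" for x :: "nat \<Rightarrow> 'a" and i :: nat
  have mem: "x i \<in> carrier R" if "x \<in> A" "i < n" for x i
    using that A by (auto simp: coord_space_def)
  have pt: "?\<phi> (pt x i) = x i" if "x \<in> A" "i < n" for x i
    unfolding pt_def using mem[OF that] surj by (intro f_inv_into_f) simp
  show ?thesis
  proof (rule frf.card_le_if_only_trivial_solutions)
    show "finite A"
      using A fin unfolding coord_space_def by (auto intro: finite_subset finite_PiE)
    fix x y z w
    assume xyzw: "x \<in> A" "y \<in> A" "z \<in> A" "w \<in> A"
      and eq: "\<forall>i<n. pt x i + pt y i + pt z i - 3 * pt w i \<in> {p. ?\<phi> p = \<zero>}"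
    have "x i \<oplus> y i \<oplus> z i = [(3::nat)] \<cdot> w i" if i: "i < n" for i
    proof -
      have three: "3 * pt w i = pt w i + pt w i + pt w i" by simp
      have "?\<phi> (3 * pt w i) = w i \<oplus> w i \<oplus> w i"
        unfolding three using xyzw i by (simp only: int_poly_eval_add[OF g] pt)
      moreover have "?\<phi> (pt x i + pt y i + pt z i) = ?\<phi> (3 * pt w i)"
        unfolding frf.phi_eq_iff using eq i by simp
      ultimately show ?thesis
        using xyzw i by (simp add: int_poly_eval_add[OF g] pt add_pow_3 mem)
    qed
    then have "is_solution R n x y z w"
      by (auto simp: is_solution_def vec_add_def vec_nat_mult_def intro!: restrict_ext)
    then show "x = y \<and> y = z \<and> z = w"
      using free xyzw unfolding has_nontrivial_solution_def trivial_solution_def by blast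
  qed
qed

text \<open>Fixing \<open>w = a\<close> and \<open>y = b\<close>, the reflection \<open>x \<mapsto> 3a - b - x\<close> must move \<open>A\<close> off itself.\<close>

lemma card_solution_free_le_half:
  assumes fin: "finite (carrier R)" and n: "n \<ge> 1" and A: "A \<subseteq> coord_space R n"
    and free: "\<not> has_nontrivial_solution R n A"
  shows "2 * card A \<le> card (carrier R) ^ n"
proof (cases "\<exists>a\<in>A. \<exists>b\<in>A. a \<noteq> b")
  case True
  then obtain a b where ab: "a \<in> A" "b \<in> A" "a \<noteq> b" by blast
  define refl where "refl x = (\<lambda>i\<in>{..<n}. [(3::nat)] \<cdot> a i \<ominus> b i \<ominus> x i)" for x
  have fin_space: "finite (coord_space R n)"
    using fin unfolding coord_space_def by (intro finite_PiE) auto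
  have mem: "x i \<in> carrier R" if "x \<in> coord_space R n" "i < n" for x i
    using that by (auto simp: coord_space_def)
  have refl_mem: "refl x \<in> coord_space R n" if "x \<in> A" for x
  proof -
    have "a i \<in> carrier R" "b i \<in> carrier R" "x i \<in> carrier R" if "i < n" for i
      using that \<open>x \<in> A\<close> ab A mem by auto
    then show ?thesis by (simp add: refl_def coord_space_def)
  qed
  have inj: "inj_on refl A"
  proof (rule inj_onI)
    fix x y assume xy: "x \<in> A" "y \<in> A" and eq: "refl x = refl y"
    show "x = y"
    proof (rule PiE_ext)
      show "x \<in> {..<n} \<rightarrow>\<^sub>E carrier R" "y \<in> {..<n} \<rightarrow>\<^sub>E carrier R"
        using xy A by (auto simp: coord_space_def)
      fix i assume i: "i \<in> {..<n}"
      have c: "a i \<in> carrier R" "b i \<in> carrier R" "x i \<in> carrier R" "y i \<in> carrier R"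
        using i ab xy A mem by auto
      have "[(3::nat)] \<cdot> a i \<ominus> b i \<ominus> x i = [(3::nat)] \<cdot> a i \<ominus> b i \<ominus> y i"
        using fun_cong[OF eq, of i] i by (simp add: refl_def)
      then have "\<ominus> x i = \<ominus> y i" using c by (simp add: a_minus_def)
      then show "x i = y i" using c by (metis minus_minus)
    qed
  qed
  \<comment> \<open>A point \<open>x\<close> of \<open>A\<close> with reflection in \<open>A\<close>
    would give the solution \<open>x, b, refl x, a\<close>, which is nontrivial since
    \<open>a\<close> and \<open>b\<close> differ.\<close>
  have "A \<inter> refl ` A = {}"
  proof (rule ccontr)
    assume "\<not> ?thesis"
    then obtain x where x: "x \<in> A" "refl x \<in> A" by blast
    have "x i \<oplus> b i \<oplus> refl x i = [(3::nat)] \<cdot> a i" if i: "i < n" for i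
    proof -
      have c: "a i \<in> carrier R" "b i \<in> carrier R" "x i \<in> carrier R"
        using i ab x A mem by auto
      have "x i \<oplus> b i \<oplus> refl x i = x i \<oplus> b i \<oplus> (\<ominus> (x i \<oplus> b i) \<oplus> [(3::nat)] \<cdot> a i)"
        using i c by (simp add: refl_def a_minus_def minus_add a_ac)
      then show ?thesis using c by (simp add: r_neg2)
    qed
    then have "is_solution R n x b (refl x) a"
      by (auto simp: is_solution_def vec_add_def vec_nat_mult_def intro!: restrict_ext)
    moreover have "\<not> trivial_solution x b (refl x) a"
      using ab(3) by (auto simp: trivial_solution_def)
    ultimately have "has_nontrivial_solution R n A"
      unfolding has_nontrivial_solution_def using x ab(1,2) by blast
    then show False using free by contradiction
  qed
  moreover have "finite A" using A fin_space by (rule finite_subset)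
  ultimately have "2 * card A = card (A \<union> refl ` A)"
    using card_image[OF inj] by (simp add: card_Un_disjoint)
  also have "\<dots> \<le> card (coord_space R n)"
    using A refl_mem by (intro card_mono fin_space) auto
  finally show ?thesis by (simp add: card_coord_space)
next
  case False
  \<comment> \<open>Without two distinct points there is no reflection to use, but the space has at
    least two elements.\<close>
  then have "A = {} \<or> (\<exists>a. A = {a})" by blast
  then have "card A \<le> 1" by auto
  moreover have "card {\<zero>, \<one>} \<le> card (carrier R)"
    by (rule card_mono[OF fin]) auto
  then have "2 \<le> card (carrier R)" by simp
  then have "2 \<le> card (carrier R) ^ n"
    using n self_le_power[of "card (carrier R)" n] by linarith
  ultimately show ?thesis by linarith
qed

end

section \<open>Counting exponent vectors of low degree\<close>

text \<open>By convexity \<open>exp\<close> lies below its chord over the interval from -3/4 to 1/4.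
  The endpoint values are bounded by inverting \<open>1 + x \<le> exp x\<close> at -1/4 and
  3/4.\<close>

lemma exp_minus_affine_le:
  fixes t :: real
  assumes "0 \<le> t" "t \<le> 1"
  shows "exp (1/4 - t) \<le> (1 - t) * (4/3) + t * (4/7)"
proof -
  have "exp (- (1/4)) \<ge> (3/4::real)" "exp (3/4) \<ge> (7/4::real)"
    using exp_ge_add_one_self[of "- (1/4)::real"] exp_ge_add_one_self[of "3/4::real"] by simp_all
  then have bounds: "exp (1/4) \<le> (4/3::real)" "exp (- (3/4)) \<le> (4/7::real)"
    by (simp_all add: exp_minus field_simps)
  have "1/4 - t = (1 - t) *\<^sub>R (1/4) + t *\<^sub>R (- (3/4))" by (simp add: field_simps)
  then have "exp (1/4 - t) = exp ((1 - t) *\<^sub>R (1/4) + t *\<^sub>R (- (3/4)))" by (rule arg_cong)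
  also have "\<dots> \<le> (1 - t) * exp (1/4) + t * exp (- (3/4))"
    by (rule convex_onD[OF exp_convex assms UNIV_I UNIV_I])
  also have "\<dots> \<le> (1 - t) * (4/3) + t * (4/7)"
    using assms bounds by (intro add_mono mult_left_mono) auto
  finally show ?thesis .
qed

text \<open>Exponential Markov inequality for the average of \<open>n\<close> independent variables uniform on
  \<open>{0, 1/(q-1), \<dots>, 1}\<close>; convexity of \<open>exp\<close> makes the rate independent of \<open>q\<close>.\<close>

lemma card_low_exponents_le:
  assumes q: "q \<ge> 2"
  shows "real (card (low_exponents q n)) \<le> real q ^ n * exp (- real n / 21)"
proof -
  define t where "t j = real j / real (q - 1)" for j
  have q1: "real (q - 1) > 0" using q by simp
  have "real (card (low_exponents q n)) = (\<Sum>e\<in>low_exponents q n. 1)" by simp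
  also have "\<dots> \<le> (\<Sum>e\<in>low_exponents q n. \<Prod>i<n. exp (1/4 - t (e i)))"
  proof (rule sum_mono)
    fix e assume "e \<in> low_exponents q n"
    then have "real (4 * (\<Sum>i<n. e i)) \<le> real (n * (q - 1))"
      unfolding low_exponents_def of_nat_le_iff by simp
    then have "4 * (\<Sum>i<n. real (e i)) \<le> real n * real (q - 1)" by simp
    then have "(\<Sum>i<n. real (e i)) / real (q - 1) \<le> real n / 4"
      unfolding pos_divide_le_eq[OF q1] by simp
    moreover have eq: "(\<Sum>i<n. 1/4 - t (e i)) = real n / 4 - (\<Sum>i<n. real (e i)) / real (q - 1)"
      by (simp add: t_def sum_subtractf sum_divide_distrib)
    ultimately have "(\<Sum>i<n. 1/4 - t (e i)) \<ge> 0" unfolding eq by (simp only: diff_ge_0_iff_ge)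
    then show "1 \<le> (\<Prod>i<n. exp (1/4 - t (e i)))"
      by (simp add: exp_sum[symmetric])
  qed
  also have "\<dots> \<le> (\<Sum>e\<in>{..<n} \<rightarrow>\<^sub>E {..<q}. \<Prod>i<n. exp (1/4 - t (e i)))"
  proof (rule sum_mono2)
    show "finite ({..<n} \<rightarrow>\<^sub>E {..<q})" by (intro finite_PiE) auto
    show "low_exponents q n \<subseteq> {..<n} \<rightarrow>\<^sub>E {..<q}" unfolding low_exponents_def by blast
  qed (simp add: prod_nonneg)
  also have "\<dots> = (\<Prod>i<n. \<Sum>j<q. exp (1/4 - t j))"
    by (rule prod_sum_PiE[symmetric]) auto
  also have "\<dots> = (\<Sum>j<q. exp (1/4 - t j)) ^ n" by simp
  also have "\<dots> \<le> (real q * exp (- 1 / 21)) ^ n"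
  proof (rule power_mono)
    have "(\<Sum>j<q. exp (1/4 - t j)) \<le> (\<Sum>j<q. (1 - t j) * (4/3) + t j * (4/7))"
      using q by (intro sum_mono exp_minus_affine_le) (auto simp: t_def)
    also have "\<dots> = real q * (4/3) - (\<Sum>j<q. t j) * (16/21)"
    proof -
      have "(1 - t j) * (4/3) + t j * (4/7) = 4/3 - t j * (16/21)" for j
        by (simp add: field_simps)
      then show ?thesis by (simp only: sum_subtractf sum_distrib_right) simp
    qed
    also have "(\<Sum>j<q. t j) = real q / 2"
    proof -
      have "(\<Sum>j<q. real j) = real q * (real q - 1) / 2"
        by (induction q) (auto simp: field_simps)
      then show ?thesis
        using q by (simp add: t_def sum_divide_distrib[symmetric] of_nat_diff)
    qed
    \<comment> \<open>Source of the rate 1/21: at the mean 1/2 of \<open>t\<close>, the chord has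
      the value (4/3 + 4/7)/2 = 20/21.\<close>
    also have "real q * (4/3) - real q / 2 * (16/21) = real q * (1 + (- 1 / 21))" by simp
    also have "\<dots> \<le> real q * exp (- 1 / 21)"
      by (intro mult_left_mono exp_ge_add_one_self) simp
    finally show "(\<Sum>j<q. exp (1/4 - t j)) \<le> real q * exp (- 1 / 21)" .
  qed (simp add: sum_nonneg)
  also have "\<dots> = real q ^ n * exp (- real n / 21)"
    by (simp add: power_mult_distrib exp_of_nat_mult[symmetric])
  finally show ?thesis .
qed

section \<open>Combination into a single exponential bound\<close>

text \<open>Up to n = 84 the exponent n/168 is at most 1/2, and \<open>exp (- 1/2)\<close> is at
  least 1/2. Beyond that, 4 is at most \<open>exp 2\<close>, and the loss of 2 is covered by n/21 -
  n/168 = n/24.\<close>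

lemma exp_bound_from_half_and_tail:
  fixes \<alpha> :: real
  assumes half: "\<alpha> \<le> 1/2" and tail: "\<alpha> \<le> 4 * exp (- real n / 21)"
  shows "\<alpha> \<le> exp (- real n / 168)"
proof (cases "n \<le> 84")
  case True
  have "1/2 \<le> exp (- 1/2 :: real)" using exp_ge_add_one_self[of "- 1/2 :: real"] by simp
  also have "\<dots> \<le> exp (- real n / 168)" using True by simp
  finally show ?thesis using half by linarith
next
  case False
  have "2 \<le> exp (1::real)" using exp_ge_add_one_self[of "1::real"] by simp
  then have "2 * 2 \<le> exp 1 * exp (1::real)" by (intro mult_mono) auto
  then have "4 \<le> exp (2::real)" by (simp add: exp_add[symmetric])
  then have "4 * exp (- real n / 21) \<le> exp 2 * exp (- real n / 21)" by simp
  also have "\<dots> = exp (2 - real n / 21)" by (simp add: exp_add[symmetric])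
  also have "\<dots> \<le> exp (- real n / 168)" using False by simp
  finally show ?thesis using tail by linarith
qed

theorem theorem1p5:
  shows "\<exists>c::real. c > 0 \<and>
    (\<forall>(q::nat) (n::nat) (F :: nat ring) (A :: (nat \<Rightarrow> nat) set) (\<alpha>::real).
       primepow q \<longrightarrow> field F \<longrightarrow> finite (carrier F) \<longrightarrow> card (carrier F) = q \<longrightarrow>
       n \<ge> 1 \<longrightarrow>
       A \<subseteq> coord_space F n \<longrightarrow>
       real (card A) = \<alpha> * real q ^ n \<longrightarrow>
       \<not> has_nontrivial_solution F n A \<longrightarrow>
       \<alpha> \<le> exp (- c * real n powr (1 / 5)))"
proof (intro exI[of _ "1/168"] conjI allI impI)
  fix q n :: nat and F :: "nat ring" and A :: "(nat \<Rightarrow> nat) set" and \<alpha> :: real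
  assume q: "primepow q" and "field F" and fin: "finite (carrier F)" and card: "card (carrier F) = q"
    and n: "n \<ge> 1" and A: "A \<subseteq> coord_space F n" and \<alpha>: "real (card A) = \<alpha> * real q ^ n"
    and free: "\<not> has_nontrivial_solution F n A"
  interpret field F by fact
  have q2: "q \<ge> 2" using primepow_gt_Suc_0[OF q] by simp
  then have qn: "real q ^ n > 0" by simp
  have "real (2 * card A) \<le> real (q ^ n)"
    using card_solution_free_le_half[OF fin n A free] card by (simp only: of_nat_le_iff)
  then have "\<alpha> * 2 * real q ^ n \<le> real q ^ n" using \<alpha> by simp
  then have half: "\<alpha> \<le> 1/2" using qn by simp
  have "real (card A) \<le> real (4 * card (low_exponents q n))"
    using card_solution_free_le_low_exponents[OF fin A free] card by (simp only: of_nat_le_iff)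
  also have "\<dots> \<le> 4 * (real q ^ n * exp (- real n / 21))"
    using card_low_exponents_le[OF q2, of n] by simp
  finally have "\<alpha> * real q ^ n \<le> 4 * exp (- real n / 21) * real q ^ n"
    unfolding \<alpha> by (simp add: mult_ac)
  then have "\<alpha> \<le> 4 * exp (- real n / 21)" using qn by simp
  then have "\<alpha> \<le> exp (- real n / 168)" by (rule exp_bound_from_half_and_tail[OF half])
  \<comment> \<open>For n at least 1 the fifth root of n is at most n, so decay exponential in n
    itself is more than enough.\<close>
  also have "\<dots> \<le> exp (- (1/168) * real n powr (1/5))"
    using n powr_mono[of "1/5" 1 "real n"] by simp
  finally show "\<alpha> \<le> exp (- (1/168) * real n powr (1/5))" .
qed simp

end
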